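(* For every formula $A$, the logic $\mathsf{IEL}$ proves each of the following formulas: 1. $\neg \mathbf{K} \bot$; 2. $\neg(\mathbf{K} A \land \neg A)$; 3. $\neg A \rightarrow \neg \mathbf{K} A$; 4. $\neg\neg(\mathbf{K} A \rightarrow A)$.
   Context: Formulas are built from a countably infinite set of propositional letters and $\bot$ using $\land,\lor,\rightarrow$ and a unary operator $\mathbf{K}$; $\neg A$ abbreviates $A\rightarrow\bot$. The Hilbert-style system $\mathsf{IEL}$ has as axioms all instances, in this language, of: the axioms of intuitionistic propositional logic; distribution $\mathbf{K}(A\rightarrow B)\rightarrow(\mathbf{K}A\rightarrow\mathbf{K}B)$; co-reflection $A\rightarrow\mathbf{K}A$; intuitionistic reflection $\mathbf{K}A\rightarrow\neg\neg A$. The only rule is Modus Ponens. "$\mathsf{IEL}$ proves $A$" means that $A$ is derivable from the axioms by the rule. *)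

theory Defs
  imports Main
begin

datatype form =
    Var nat
  | Bot  (\<open>\<^bold>\<bottom>\<close>)
  | And form form  (infixr \<open>\<^bold>\<and>\<close> 65)
  | Or form form  (infixr \<open>\<^bold>\<or>\<close> 60)
  | Imp form form  (infixr \<open>\<^bold>\<rightarrow>\<close> 55)
  | Know form  (\<open>\<^bold>K _\<close> [80] 80)

abbreviation Neg :: "form \<Rightarrow> form"  (\<open>\<^bold>\<not> _\<close> [80] 80)
  where "\<^bold>\<not> A \<equiv> A \<^bold>\<rightarrow> \<^bold>\<bottom>"

text \<open>
  A standard Hilbert axiomatization of intuitionistic propositional logic. The schematic
  variables range over all formulas of the epistemic language, including those that contain
  the operator \<open>\<^bold>K\<close>.
\<close>

inductive ipc_axiom :: "form \<Rightarrow> bool" where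
  imp_k: "ipc_axiom (A \<^bold>\<rightarrow> (B \<^bold>\<rightarrow> A))"
| imp_s: "ipc_axiom ((A \<^bold>\<rightarrow> (B \<^bold>\<rightarrow> C)) \<^bold>\<rightarrow> ((A \<^bold>\<rightarrow> B) \<^bold>\<rightarrow> (A \<^bold>\<rightarrow> C)))"
| and_left: "ipc_axiom ((A \<^bold>\<and> B) \<^bold>\<rightarrow> A)"
| and_right: "ipc_axiom ((A \<^bold>\<and> B) \<^bold>\<rightarrow> B)"
| and_intro: "ipc_axiom (A \<^bold>\<rightarrow> (B \<^bold>\<rightarrow> (A \<^bold>\<and> B)))"
| or_left: "ipc_axiom (A \<^bold>\<rightarrow> (A \<^bold>\<or> B))"
| or_right: "ipc_axiom (B \<^bold>\<rightarrow> (A \<^bold>\<or> B))"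
| or_elim: "ipc_axiom ((A \<^bold>\<rightarrow> C) \<^bold>\<rightarrow> ((B \<^bold>\<rightarrow> C) \<^bold>\<rightarrow> ((A \<^bold>\<or> B) \<^bold>\<rightarrow> C)))"
| ex_falso: "ipc_axiom (\<^bold>\<bottom> \<^bold>\<rightarrow> A)"

inductive iel_axiom :: "form \<Rightarrow> bool" where
  ipc: "ipc_axiom A \<Longrightarrow> iel_axiom A"
| distribution: "iel_axiom (\<^bold>K (A \<^bold>\<rightarrow> B) \<^bold>\<rightarrow> (\<^bold>K A \<^bold>\<rightarrow> \<^bold>K B))"
| co_reflection: "iel_axiom (A \<^bold>\<rightarrow> \<^bold>K A)"
| int_reflection: "iel_axiom (\<^bold>K A \<^bold>\<rightarrow> \<^bold>\<not> (\<^bold>\<not> A))"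

inductive IEL :: "form \<Rightarrow> bool"  (\<open>\<turnstile>\<^sub>I\<^sub>E\<^sub>L _\<close> [50] 50) where
  axiom: "iel_axiom A \<Longrightarrow> \<turnstile>\<^sub>I\<^sub>E\<^sub>L A"
| modus_ponens: "\<turnstile>\<^sub>I\<^sub>E\<^sub>L A \<^bold>\<rightarrow> B \<Longrightarrow> \<turnstile>\<^sub>I\<^sub>E\<^sub>L A \<Longrightarrow> \<turnstile>\<^sub>I\<^sub>E\<^sub>L B"

end

(* Derivability from hypotheses satisfies the deduction theorem, since Modus Ponens is the only
   rule. One may therefore argue by natural deduction, and all four formulas come down to
   intuitionistic reflection: K A and not A together yield falsity. For the last one, a refutation
   of K A -> A refutes A, hence K A, hence makes K A -> A true ex falso. *)
theory Submission
  imports Defs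
begin

text \<open>Hypotheses form a set, fixed throughout a derivation, so they can be cited in any order
  without structural rules. The empty set gives back \<open>IEL\<close>.\<close>

inductive derives :: "form set \<Rightarrow> form \<Rightarrow> bool"  (infix \<open>\<tturnstile>\<close> 50)
  for H :: "form set" where
  hyp: "A \<in> H \<Longrightarrow> H \<tturnstile> A"
| ax: "iel_axiom A \<Longrightarrow> H \<tturnstile> A"
| mp: "H \<tturnstile> A \<^bold>\<rightarrow> B \<Longrightarrow> H \<tturnstile> A \<Longrightarrow> H \<tturnstile> B"

lemma IEL_if_derives_empty: "{} \<tturnstile> A \<Longrightarrow> \<turnstile>\<^sub>I\<^sub>E\<^sub>L A"
  by (induction rule: derives.induct) (auto intro: IEL.intros)

lemma derives_imp_k: "H \<tturnstile> A \<Longrightarrow> H \<tturnstile> B \<^bold>\<rightarrow> A"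
  by (meson ax iel_axiom.ipc imp_k mp)

lemma derives_imp_s: "H \<tturnstile> A \<^bold>\<rightarrow> B \<^bold>\<rightarrow> C \<Longrightarrow> H \<tturnstile> A \<^bold>\<rightarrow> B \<Longrightarrow> H \<tturnstile> A \<^bold>\<rightarrow> C"
  by (meson ax iel_axiom.ipc imp_s mp)

text \<open>The combinator identity S K K = I, with A -> A as the middle formula.\<close>

lemma derives_imp_refl: "H \<tturnstile> A \<^bold>\<rightarrow> A"
proof (rule derives_imp_s)
  show "H \<tturnstile> A \<^bold>\<rightarrow> (A \<^bold>\<rightarrow> A) \<^bold>\<rightarrow> A" and "H \<tturnstile> A \<^bold>\<rightarrow> A \<^bold>\<rightarrow> A"
    by (intro ax iel_axiom.ipc imp_k)+
qed

text \<open>Induction on the derivation: the discharged hypothesis becomes an identity, other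
  hypotheses and axioms are prefixed by \<open>imp_k\<close>, and Modus Ponens is carried out under
  the prefix by \<open>imp_s\<close>.\<close>

theorem deduction: "insert A H \<tturnstile> B \<Longrightarrow> H \<tturnstile> A \<^bold>\<rightarrow> B"
  by (induction rule: derives.induct)
    (auto intro: derives_imp_refl derives_imp_k derives_imp_s hyp ax)

lemma derives_conjunct1: "H \<tturnstile> A \<^bold>\<and> B \<Longrightarrow> H \<tturnstile> A"
  by (meson ax iel_axiom.ipc and_left mp)

lemma derives_conjunct2: "H \<tturnstile> A \<^bold>\<and> B \<Longrightarrow> H \<tturnstile> B"
  by (meson ax iel_axiom.ipc and_right mp)

lemma derives_ex_falso: "H \<tturnstile> \<^bold>\<bottom> \<Longrightarrow> H \<tturnstile> A"
  by (meson ax iel_axiom.ipc ex_falso mp)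

lemma derives_Know_Neg: "H \<tturnstile> \<^bold>K A \<Longrightarrow> H \<tturnstile> \<^bold>\<not> A \<Longrightarrow> H \<tturnstile> \<^bold>\<bottom>"
  by (meson ax int_reflection mp)

theorem theorem1:
  fixes A :: form
  shows "(\<turnstile>\<^sub>I\<^sub>E\<^sub>L \<^bold>\<not> (\<^bold>K \<^bold>\<bottom>)) \<and>
    (\<turnstile>\<^sub>I\<^sub>E\<^sub>L \<^bold>\<not> (\<^bold>K A \<^bold>\<and> \<^bold>\<not> A)) \<and>
    (\<turnstile>\<^sub>I\<^sub>E\<^sub>L \<^bold>\<not> A \<^bold>\<rightarrow> \<^bold>\<not> (\<^bold>K A)) \<and>
    (\<turnstile>\<^sub>I\<^sub>E\<^sub>L \<^bold>\<not> (\<^bold>\<not> (\<^bold>K A \<^bold>\<rightarrow> A)))"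
proof (intro conjI; rule IEL_if_derives_empty; rule deduction)
  show "{\<^bold>K \<^bold>\<bottom>} \<tturnstile> \<^bold>\<bottom>"
    \<comment> \<open>The negation of falsity is itself an identity implication.\<close>
    by (rule derives_Know_Neg[OF hyp derives_imp_refl]) simp
next
  let ?H = "{\<^bold>K A \<^bold>\<and> \<^bold>\<not> A}"
  have conj: "?H \<tturnstile> \<^bold>K A \<^bold>\<and> \<^bold>\<not> A"
    by (simp add: hyp)
  show "?H \<tturnstile> \<^bold>\<bottom>"
    by (rule derives_Know_Neg[OF conj[THEN derives_conjunct1] conj[THEN derives_conjunct2]])
next
  show "{\<^bold>\<not> A} \<tturnstile> \<^bold>\<not> (\<^bold>K A)"
    by (rule deduction, rule derives_Know_Neg[of _ A]) (simp_all add: hyp)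
next
  let ?N = "\<^bold>\<not> (\<^bold>K A \<^bold>\<rightarrow> A)"
  \<comment> \<open>The set \<open>H\<close> is left arbitrary because the contradiction with
    \<open>?N\<close> is needed both under \<open>?N\<close> alone and with A or K A added.\<close>
  have absurd: "H \<tturnstile> \<^bold>\<bottom>" if "?N \<in> H" "H \<tturnstile> \<^bold>K A \<^bold>\<rightarrow> A" for H
    by (rule mp[OF hyp[OF that(1)] that(2)])
  \<comment> \<open>Assuming A, weakening gives K A -> A, against \<open>?N\<close>.\<close>
  have neg: "H \<tturnstile> \<^bold>\<not> A" if "?N \<in> H" for H
    by (rule deduction, rule absurd) (simp_all add: that derives_imp_k hyp)
  have "{\<^bold>K A, ?N} \<tturnstile> \<^bold>\<bottom>"
    by (rule derives_Know_Neg[OF hyp neg]) simp_all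
  then have "{?N} \<tturnstile> \<^bold>K A \<^bold>\<rightarrow> A"
    \<comment> \<open>Falsity under K A yields A, and then K A is discharged.\<close>
    by (rule deduction[OF derives_ex_falso])
  then show "{?N} \<tturnstile> \<^bold>\<bottom>"
    by (simp add: absurd)
qed

end
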